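(* Let $\mathsf{L}(t)=\sum_{n=0}^\infty \mathcal{L}_n\frac{t^n}{n!}$ be the exponential generating function of the Lucas-Fubini numbers. For every integer $r\ge 1$, its $r$th derivative is $$\mathsf{L}^{(r)}(t)=\sum_{i=1}^{r}e^{it}{r \brace i} \left(\alpha^{i+1} e^{\alpha (e^t-1)}+\beta^{i+1} e^{\beta (e^t-1)}\right).$$
   Context: $\alpha=(1+\sqrt5)/2$ and $\beta=(1-\sqrt5)/2$. ${n\brace k}$ denotes the Stirling number of the second kind (the number of partitions of an $n$-element set into exactly $k$ non-empty blocks). $L_m$ denotes the Lucas numbers: $L_0=2$, $L_1=1$, $L_m=L_{m-1}+L_{m-2}$ for $m\ge2$. The Lucas-Fubini numbers are defined by $\mathcal{L}_n=\sum_{k=0}^n L_{k+1}{n\brace k}$ for $n\ge0$. The identity is one of formal power series in $t$, with derivative taken with respect to $t$. *)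

theory Defs
  imports
    Complex_Main
    "HOL-Combinatorics.Stirling"
    "HOL-Computational_Algebra.Formal_Power_Series"
begin

definition golden_ratio :: real
  where "golden_ratio = (1 + sqrt 5) / 2"

definition golden_conj :: real
  where "golden_conj = (1 - sqrt 5) / 2"

fun lucas_number :: "nat \<Rightarrow> nat"
  where
    "lucas_number 0 = 2"
  | "lucas_number (Suc 0) = 1"
  | "lucas_number (Suc (Suc m)) = lucas_number (Suc m) + lucas_number m"

definition lucas_fubini :: "nat \<Rightarrow> nat"
  where "lucas_fubini n = (\<Sum>k=0..n. lucas_number (k + 1) * Stirling n k)"

definition lucas_fubini_egf :: "real fps"
  where "lucas_fubini_egf = Abs_fps (\<lambda>n. real (lucas_fubini n) / fact n)"

(* exp (c (e^t - 1)), read as the composition of the series exp (c x) with e^t - 1.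
   The composition oo is only meaningful if the inner series has zero constant term,
   which is the case here. *)
definition fps_exp_exp :: "real \<Rightarrow> real fps"
  where "fps_exp_exp c = fps_exp c oo (fps_exp 1 - 1)"

end

theory Submission
  imports Defs
begin

unbundle fps_syntax

text \<open>
  Since \<open>(e\<^sup>t - 1)\<^sup>k / k!\<close> is the exponential generating function of the Stirling numbers
  of the second kind, Binet's formula splits the Lucas-Fubini series into
  \<open>\<alpha> F\<^sub>\<alpha> + \<beta> F\<^sub>\<beta>\<close> with \<open>F\<^sub>c = exp (c (e\<^sup>t - 1))\<close>. Each \<open>F\<^sub>c\<close> satisfies \<open>F\<^sub>c' = c e\<^sup>t F\<^sub>c\<close>, so
  differentiating \<open>e\<^sup>i\<^sup>t F\<^sub>c\<close> gives \<open>i e\<^sup>i\<^sup>t F\<^sub>c + c e\<^bsup>(i+1)t\<^esup> F\<^sub>c\<close>, which on coefficients is the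
  recurrence of the Stirling numbers.
\<close>

text \<open>With \<open>g = e^t - 1\<close>, the derivative of \<open>g^k\<close> is
  \<open>k e^t g^(k-1) = k (g^k + g^(k-1))\<close>, since \<open>e^t = g + 1\<close>. Comparing
  coefficients yields the Stirling recurrence, up to factorials.\<close>

lemma fps_exp_minus_1_power_nth:
  "((fps_exp 1 - 1) ^ k) $ n = (fact k * of_nat (Stirling n k) / fact n :: 'a :: field_char_0)"
proof (induction n arbitrary: k)
  case 0
  show ?case
    by (cases k) (simp_all add: fps_nth_power_0)
next
  case (Suc n)
  show ?case
  proof (cases k)
    case 0
    then show ?thesis by simp
  next
    case (Suc j)
    let ?g = "fps_exp 1 - 1 :: 'a fps"
    have "fps_deriv (?g ^ k) = of_nat k * fps_exp 1 * ?g ^ j"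
      unfolding fps_deriv_power' by (simp add: Suc)
    also have "\<dots> = of_nat k * (?g ^ k + ?g ^ j)"
      by (simp add: Suc algebra_simps)
    finally have "fps_deriv (?g ^ k) $ n = of_nat k * ((?g ^ k) $ n + (?g ^ j) $ n)"
      by (simp add: fps_mult_of_nat_nth)
    then have "of_nat (Suc n) * (?g ^ k) $ Suc n =
        of_nat k * ((?g ^ k) $ n + (?g ^ j) $ n)"
      by simp
    also have "\<dots> = of_nat (Suc n) * (fact k * of_nat (Stirling (Suc n) k) / fact (Suc n))"
      unfolding Suc.IH
      by (simp add: Suc field_simps del: of_nat_Suc) (simp add: algebra_simps)
    finally show ?thesis
      by (metis mult_cancel_left of_nat_eq_0_iff nat.distinct(2))
  qed
qed

lemma fps_exp_exp_nth:
  "fps_exp_exp c $ n = (\<Sum>k=0..n. c ^ k * real (Stirling n k)) / fact n"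
  unfolding fps_exp_exp_def
  by (simp add: fps_compose_nth fps_exp_minus_1_power_nth sum_divide_distrib)

lemma fps_deriv_fps_exp_exp:
  "fps_deriv (fps_exp_exp c) = fps_const c * fps_exp 1 * fps_exp_exp c"
  unfolding fps_exp_exp_def
  by (simp add: fps_compose_deriv fps_compose_mult_distrib algebra_simps)

text \<open>Starting the sum at \<open>i = 0\<close> covers \<open>r = 0\<close>, where
  \<open>Stirling 0 0 = 1\<close>, so the induction can begin there.\<close>

lemma fps_nth_deriv_fps_exp_exp:
  "fps_nth_deriv r (fps_exp_exp c) =
    (\<Sum>i\<le>r. fps_exp (real i) * of_nat (Stirling r i) * (fps_const (c ^ i) * fps_exp_exp c))"
proof (induction r)
  case 0
  then show ?case by simp
next
  case (Suc r)
  let ?T = "\<lambda>i. fps_exp (real i) * (fps_const (c ^ i) * fps_exp_exp c)"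
  have T': "fps_deriv (?T i) = of_nat i * ?T i + ?T (Suc i)" for i
    by (simp add: fps_deriv_fps_exp_exp fps_exp_add_mult algebra_simps
        fps_of_nat [symmetric] del: fps_of_nat flip: fps_const_mult)
  have "fps_nth_deriv (Suc r) (fps_exp_exp c) =
      (\<Sum>i\<le>r. of_nat (Stirling r i) * fps_deriv (?T i))"
    by (simp add: fps_nth_deriv_commute Suc.IH fps_deriv_sum algebra_simps
        del: fps_nth_deriv.simps)
  also have "\<dots> = (\<Sum>i\<le>r. of_nat (i * Stirling r i) * ?T i) +
      (\<Sum>i\<le>r. of_nat (Stirling r i) * ?T (Suc i))"
    by (simp only: T') (simp add: algebra_simps sum.distrib)
  \<comment> \<open>The added term vanishes because \<open>Stirling r (Suc r) = 0\<close>. The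
    factor \<open>i\<close> then kills the term at 0, so shifting the index aligns both sums on
    \<open>?T (Suc i)\<close>.\<close>
  also have "(\<Sum>i\<le>r. of_nat (i * Stirling r i) * ?T i) =
      (\<Sum>i\<le>Suc r. of_nat (i * Stirling r i) * ?T i)"
    by simp
  also have "\<dots> = (\<Sum>i\<le>r. of_nat (Suc i * Stirling r (Suc i)) * ?T (Suc i))"
    by (subst sum.atMost_Suc_shift) simp
  also have "\<dots> + (\<Sum>i\<le>r. of_nat (Stirling r i) * ?T (Suc i)) =
      (\<Sum>i\<le>r. of_nat (Stirling (Suc r) (Suc i)) * ?T (Suc i))"
    by (simp add: sum.distrib [symmetric] algebra_simps)
  \<comment> \<open>The term at 0 can be restored since
    \<open>Stirling (Suc r) 0 = 0\<close>.\<close>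
  also have "\<dots> = (\<Sum>i\<le>Suc r. of_nat (Stirling (Suc r) i) * ?T i)"
    by (subst sum.atMost_Suc_shift) simp
  finally show ?case
    by (simp only: mult_ac)
qed

text \<open>Both bases are roots of \<open>x^2 = x + 1\<close>, so their powers obey the Lucas
  recurrence.\<close>

lemma lucas_number_binet: "real (lucas_number m) = golden_ratio ^ m + golden_conj ^ m"
proof (induction m rule: lucas_number.induct)
  case (3 m)
  have "golden_ratio\<^sup>2 = golden_ratio + 1" "golden_conj\<^sup>2 = golden_conj + 1"
    by (simp_all add: golden_ratio_def golden_conj_def power2_eq_square field_simps)
  then have "golden_ratio ^ Suc (Suc m) = golden_ratio ^ Suc m + golden_ratio ^ m"
    "golden_conj ^ Suc (Suc m) = golden_conj ^ Suc m + golden_conj ^ m"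
    by (simp_all add: power2_eq_square algebra_simps flip: mult.assoc)
  then show ?case
    using 3 by simp
qed (simp_all add: golden_ratio_def golden_conj_def field_simps)

text \<open>The outer constant factors come from the index shift in
  \<open>lucas_number (k + 1)\<close>.\<close>

lemma lucas_fubini_egf_eq:
  "lucas_fubini_egf = fps_const golden_ratio * fps_exp_exp golden_ratio +
     fps_const golden_conj * fps_exp_exp golden_conj"
proof (rule fps_ext)
  fix n
  show "lucas_fubini_egf $ n = (fps_const golden_ratio * fps_exp_exp golden_ratio +
     fps_const golden_conj * fps_exp_exp golden_conj) $ n"
    by (simp add: lucas_fubini_egf_def lucas_fubini_def lucas_number_binet fps_exp_exp_nth
        add_divide_distrib sum_distrib_left sum.distrib ring_distribs mult.assoc
        del: lucas_number.simps)
qed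

theorem theorem8:
  fixes r :: nat
  assumes "r \<ge> 1"
  shows "fps_nth_deriv r lucas_fubini_egf =
    (\<Sum>i=1..r. fps_exp (real i) * of_nat (Stirling r i) *
      (fps_const (golden_ratio ^ (i + 1)) * fps_exp_exp golden_ratio +
       fps_const (golden_conj ^ (i + 1)) * fps_exp_exp golden_conj))"
proof -
  have "fps_nth_deriv r lucas_fubini_egf =
    (\<Sum>i\<le>r. fps_exp (real i) * of_nat (Stirling r i) *
      (fps_const (golden_ratio ^ (i + 1)) * fps_exp_exp golden_ratio +
       fps_const (golden_conj ^ (i + 1)) * fps_exp_exp golden_conj))"
    by (simp add: lucas_fubini_egf_eq fps_nth_deriv_fps_exp_exp sum_distrib_left
        algebra_simps flip: fps_const_mult sum.distrib)
  also have "\<dots> = (\<Sum>i=1..r. fps_exp (real i) * of_nat (Stirling r i) *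
      (fps_const (golden_ratio ^ (i + 1)) * fps_exp_exp golden_ratio +
       fps_const (golden_conj ^ (i + 1)) * fps_exp_exp golden_conj))"
  \<comment> \<open>Only \<open>i = 0\<close> is dropped; its coefficient
    \<open>Stirling r 0\<close> is zero because \<open>r\<close> is positive.\<close>
  proof (rule sum.mono_neutral_right)
    show "\<forall>i\<in>{..r} - {1..r}. fps_exp (real i) * of_nat (Stirling r i) *
      (fps_const (golden_ratio ^ (i + 1)) * fps_exp_exp golden_ratio +
       fps_const (golden_conj ^ (i + 1)) * fps_exp_exp golden_conj) = 0"
      using assms by (cases r) (auto simp: not_le)
  qed auto
  finally show ?thesis .
qed

end
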